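(* For every $d\in\mathbb{N}$, every bilipschitz equivalence class of separated nets in $\mathbb{R}^{d}$ decomposes as a union of uncountably many pairwise distinct bounded displacement equivalence classes.
   Context: A set $Z\subseteq\mathbb{R}^d$ is separated if $\inf\{\|z-z'\|_2: z,z'\in Z,\ z\ne z'\}>0$, and a net of $\mathbb{R}^d$ if $\sup_{x\in\mathbb{R}^d}\inf_{z\in Z}\|z-x\|_2<\infty$; a separated net is a set that is both. Two separated nets $X,Y\subseteq\mathbb{R}^d$ are bilipschitz equivalent if there is a bijection $X\to Y$ that is Lipschitz with Lipschitz inverse (with respect to the Euclidean distance). They are bounded displacement equivalent if there is a bijection $f\colon X\to Y$ with $\sup_{x\in X}\|f(x)-x\|_2<\infty$. Both are equivalence relations on the set of separated nets of $\mathbb{R}^d$, and the equivalence classes are meant with respect to these relations. *)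

theory Defs
  imports "HOL-Analysis.Analysis"
begin

(* The infima and suprema are taken in the extended reals, so that the infimum over the empty set
   is \<infinity>: the empty set is separated but not a net. *)

definition separated :: "'a::real_normed_vector set \<Rightarrow> bool" where
  "separated Z \<longleftrightarrow> Inf {ereal (norm (z - z')) |z z'. z \<in> Z \<and> z' \<in> Z \<and> z \<noteq> z'} > 0"

definition net :: "'a::real_normed_vector set \<Rightarrow> bool" where
  "net Z \<longleftrightarrow> (SUP x. INF z\<in>Z. ereal (norm (z - x))) < \<infinity>"

definition separated_nets :: "'a::real_normed_vector set set" where
  "separated_nets = {Z. separated Z \<and> net Z}"

definition bilipschitz_equivalent :: "'a::real_normed_vector set \<Rightarrow> 'a set \<Rightarrow> bool" where
  "bilipschitz_equivalent X Y \<longleftrightarrow>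
     (\<exists>f. bij_betw f X Y \<and> (\<exists>L. L-lipschitz_on X f) \<and> (\<exists>L. L-lipschitz_on Y (inv_into X f)))"

definition bd_equivalent :: "'a::real_normed_vector set \<Rightarrow> 'a set \<Rightarrow> bool" where
  "bd_equivalent X Y \<longleftrightarrow>
     (\<exists>f. bij_betw f X Y \<and> (SUP x\<in>X. ereal (norm (f x - x))) < \<infinity>)"

definition bilipschitz_rel :: "('a::real_normed_vector set \<times> 'a set) set" where
  "bilipschitz_rel =
     {(X, Y). X \<in> separated_nets \<and> Y \<in> separated_nets \<and> bilipschitz_equivalent X Y}"

definition bd_rel :: "('a::real_normed_vector set \<times> 'a set) set" where
  "bd_rel = {(X, Y). X \<in> separated_nets \<and> Y \<in> separated_nets \<and> bd_equivalent X Y}"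

lemma separated_iff:
  "separated Z \<longleftrightarrow> (\<exists>\<delta>>0. \<forall>z\<in>Z. \<forall>z'\<in>Z. z \<noteq> z' \<longrightarrow> \<delta> \<le> norm (z - z'))"
proof
  assume "separated Z"
  then obtain r where r: "0 < ereal r"
    "ereal r < Inf {ereal (norm (z - z')) |z z'. z \<in> Z \<and> z' \<in> Z \<and> z \<noteq> z'}"
    unfolding separated_def using ereal_dense2 by blast
  have "r \<le> norm (z - z')" if "z \<in> Z" "z' \<in> Z" "z \<noteq> z'" for z z'
  proof -
    have "ereal r < ereal (norm (z - z'))"
      using that by (intro less_le_trans[OF r(2)] Inf_lower) blast
    then show ?thesis by simp
  qed
  then show "\<exists>\<delta>>0. \<forall>z\<in>Z. \<forall>z'\<in>Z. z \<noteq> z' \<longrightarrow> \<delta> \<le> norm (z - z')"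
    using r(1) by (intro exI[of _ r]) auto
next
  assume "\<exists>\<delta>>0. \<forall>z\<in>Z. \<forall>z'\<in>Z. z \<noteq> z' \<longrightarrow> \<delta> \<le> norm (z - z')"
  then obtain \<delta> where d: "\<delta> > 0" "\<forall>z\<in>Z. \<forall>z'\<in>Z. z \<noteq> z' \<longrightarrow> \<delta> \<le> norm (z - z')" by blast
  have "ereal \<delta> \<le> Inf {ereal (norm (z - z')) |z z'. z \<in> Z \<and> z' \<in> Z \<and> z \<noteq> z'}"
    using d(2) by (intro Inf_greatest) auto
  moreover have "0 < ereal \<delta>" using d(1) by simp
  ultimately show "separated Z"
    unfolding separated_def by order
qed

lemma net_iff: "net Z \<longleftrightarrow> (\<exists>R. \<forall>x. \<exists>z\<in>Z. norm (z - x) \<le> R)"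
proof
  assume "net Z"
  then obtain r where r: "(SUP x. INF z\<in>Z. ereal (norm (z - x))) < ereal r"
    unfolding net_def using ereal_dense2 by blast
  have "\<exists>z\<in>Z. norm (z - x) \<le> r" for x
  proof -
    have "(INF z\<in>Z. ereal (norm (z - x))) < ereal r"
      by (rule le_less_trans[OF SUP_upper r]) simp
    then show ?thesis by (auto simp: INF_less_iff intro: less_imp_le)
  qed
  then show "\<exists>R. \<forall>x. \<exists>z\<in>Z. norm (z - x) \<le> R" by blast
next
  assume "\<exists>R. \<forall>x. \<exists>z\<in>Z. norm (z - x) \<le> R"
  then obtain R where R: "\<forall>x. \<exists>z\<in>Z. norm (z - x) \<le> R" by blast
  have "(SUP x. INF z\<in>Z. ereal (norm (z - x))) \<le> ereal R"
  proof (rule SUP_least)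
    fix x
    obtain z where "z \<in> Z" "norm (z - x) \<le> R" using R by blast
    then show "(INF z\<in>Z. ereal (norm (z - x))) \<le> ereal R" by (intro INF_lower2[of z]) auto
  qed
  then show "net Z" unfolding net_def by (rule le_less_trans) simp
qed

lemma sup_norm_finite_iff:
  "(SUP x\<in>X. ereal (norm (g x))) < \<infinity> \<longleftrightarrow> (\<exists>C. \<forall>x\<in>X. norm (g x) \<le> C)"
proof
  assume "(SUP x\<in>X. ereal (norm (g x))) < \<infinity>"
  then obtain r where r: "(SUP x\<in>X. ereal (norm (g x))) < ereal r"
    using ereal_dense2 by blast
  have "norm (g x) \<le> r" if "x \<in> X" for x
  proof -
    have "ereal (norm (g x)) < ereal r" by (rule le_less_trans[OF SUP_upper[OF that] r])
    then show ?thesis by simp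
  qed
  then show "\<exists>C. \<forall>x\<in>X. norm (g x) \<le> C" by blast
next
  assume "\<exists>C. \<forall>x\<in>X. norm (g x) \<le> C"
  then obtain C where "\<forall>x\<in>X. norm (g x) \<le> C" by blast
  then have "(SUP x\<in>X. ereal (norm (g x))) \<le> ereal C" by (intro SUP_least) auto
  then show "(SUP x\<in>X. ereal (norm (g x))) < \<infinity>" by (rule le_less_trans) simp
qed

lemma bd_equivalent_iff:
  "bd_equivalent X Y \<longleftrightarrow> (\<exists>f. bij_betw f X Y \<and> (\<exists>C. \<forall>x\<in>X. norm (f x - x) \<le> C))"
  unfolding bd_equivalent_def sup_norm_finite_iff ..

lemma bilipschitz_equivalent_refl: "bilipschitz_equivalent X X"
proof -
  have "inv_into X (\<lambda>x. x) x = x" if "x \<in> X" for x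
    using inv_into_f_f[of "\<lambda>x. x" X x] that by simp
  then have "1-lipschitz_on X (inv_into X (\<lambda>x. x))"
    by (intro lipschitz_on_transform[OF lipschitz_on_id]) auto
  moreover have "bij_betw (\<lambda>x. x) X X"
    by (simp add: bij_betw_def)
  ultimately show ?thesis
    unfolding bilipschitz_equivalent_def using lipschitz_on_id by blast
qed

lemma bilipschitz_equivalent_sym:
  assumes "bilipschitz_equivalent X Y"
  shows "bilipschitz_equivalent Y X"
proof -
  obtain f K L where f: "bij_betw f X Y" "K-lipschitz_on X f" "L-lipschitz_on Y (inv_into X f)"
    using assms unfolding bilipschitz_equivalent_def by blast
  have "K-lipschitz_on X (inv_into Y (inv_into X f))"
    using inv_into_inv_into_eq[OF f(1)] by (intro lipschitz_on_transform[OF f(2)]) auto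
  then show ?thesis
    unfolding bilipschitz_equivalent_def using f bij_betw_inv_into by blast
qed

lemma bilipschitz_equivalent_trans:
  assumes "bilipschitz_equivalent X Y" "bilipschitz_equivalent Y Z"
  shows "bilipschitz_equivalent X Z"
proof -
  obtain f K L where f: "bij_betw f X Y" "K-lipschitz_on X f" "L-lipschitz_on Y (inv_into X f)"
    using assms(1) unfolding bilipschitz_equivalent_def by blast
  obtain g M N where g: "bij_betw g Y Z" "M-lipschitz_on Y g" "N-lipschitz_on Z (inv_into Y g)"
    using assms(2) unfolding bilipschitz_equivalent_def by blast
  have im: "f ` X = Y" "inv_into Y g ` Z = Y"
    using f(1) g(1) bij_betw_inv_into by (auto simp: bij_betw_def)
  have 1: "(M * K)-lipschitz_on X (g \<circ> f)"
    using f(2) g(2) im by (intro lipschitz_on_compose) auto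
  have "(L * N)-lipschitz_on Z (inv_into X f \<circ> inv_into Y g)"
    using f(3) g(3) im by (intro lipschitz_on_compose) auto
  moreover have inv: "inv_into X (g \<circ> f) z = (inv_into X f \<circ> inv_into Y g) z" if "z \<in> Z" for z
    using inv_into_comp[of g f X z] f(1) g(1) that by (simp add: bij_betw_def)
  ultimately have "(L * N)-lipschitz_on Z (inv_into X (g \<circ> f))"
    by (rule lipschitz_on_transform) (use inv in simp)
  then show ?thesis
    unfolding bilipschitz_equivalent_def using 1 bij_betw_trans[OF f(1) g(1)] by blast
qed

lemma bd_equivalent_refl: "bd_equivalent X X"
  unfolding bd_equivalent_iff by (intro exI[of _ id]) auto

lemma bd_equivalent_sym:
  assumes "bd_equivalent X Y"
  shows "bd_equivalent Y X"
proof -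
  obtain f C where f: "bij_betw f X Y" "\<forall>x\<in>X. norm (f x - x) \<le> C"
    using assms unfolding bd_equivalent_iff by blast
  have "norm (inv_into X f y - y) \<le> C" if "y \<in> Y" for y
  proof -
    have "y \<in> f ` X" using f(1) that by (simp add: bij_betw_def)
    then have "inv_into X f y \<in> X" "f (inv_into X f y) = y"
      by (auto intro: inv_into_into f_inv_into_f)
    then show ?thesis using f(2) by (metis norm_minus_commute)
  qed
  then show ?thesis unfolding bd_equivalent_iff using bij_betw_inv_into[OF f(1)] by blast
qed

lemma bd_equivalent_trans:
  assumes "bd_equivalent X Y" "bd_equivalent Y Z"
  shows "bd_equivalent X Z"
proof -
  obtain f C where f: "bij_betw f X Y" "\<forall>x\<in>X. norm (f x - x) \<le> C"
    using assms(1) unfolding bd_equivalent_iff by blast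
  obtain g D where g: "bij_betw g Y Z" "\<forall>x\<in>Y. norm (g x - x) \<le> D"
    using assms(2) unfolding bd_equivalent_iff by blast
  have "norm ((g \<circ> f) x - x) \<le> D + C" if "x \<in> X" for x
  proof -
    have "f x \<in> Y" using f(1) that by (auto simp: bij_betw_def)
    then have "norm (g (f x) - f x) \<le> D" "norm (f x - x) \<le> C" using f(2) g(2) that by auto
    then show ?thesis using norm_triangle_ineq[of "g (f x) - f x" "f x - x"] by simp
  qed
  then show ?thesis
    unfolding bd_equivalent_iff using bij_betw_trans[OF f(1) g(1)] by blast
qed

lemma equiv_bilipschitz_rel: "equiv separated_nets bilipschitz_rel"
proof (rule equivI)
  show "bilipschitz_rel \<subseteq> separated_nets \<times> separated_nets"
    unfolding bilipschitz_rel_def by blast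
  show "refl_on separated_nets bilipschitz_rel"
    unfolding bilipschitz_rel_def refl_on_def by (simp add: bilipschitz_equivalent_refl)
  show "sym bilipschitz_rel"
    unfolding bilipschitz_rel_def sym_def by (simp add: bilipschitz_equivalent_sym)
  show "trans bilipschitz_rel"
    unfolding bilipschitz_rel_def trans_def by (auto elim: bilipschitz_equivalent_trans)
qed

lemma equiv_bd_rel: "equiv separated_nets bd_rel"
proof (rule equivI)
  show "bd_rel \<subseteq> separated_nets \<times> separated_nets"
    unfolding bd_rel_def by blast
  show "refl_on separated_nets bd_rel"
    unfolding bd_rel_def refl_on_def by (simp add: bd_equivalent_refl)
  show "sym bd_rel"
    unfolding bd_rel_def sym_def by (simp add: bd_equivalent_sym)
  show "trans bd_rel"
    unfolding bd_rel_def trans_def by (auto elim: bd_equivalent_trans)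
qed

end

theory Submission
  imports Defs
begin

text \<open>
  Scaling a separated net \<open>X\<close> by \<open>t > 0\<close> is a bilipschitz map, so all the nets \<open>t X\<close> lie in the
  bilipschitz class of \<open>X\<close>. They are pairwise not bounded displacement equivalent
  (\<open>not_bd_equivalent_scaleR\<close>): suppose that \<open>f : t X \<rightarrow> s X\<close> is a bijection with bounded
  displacement, \<open>0 < t < s\<close>. Then \<open>g x = f (t x) / s\<close> is a permutation of \<open>X\<close> that is within bounded
  distance of the contraction \<open>x \<mapsto> (t/s) x\<close>. Such a permutation maps the points of \<open>X\<close> in a large
  ball into that ball, and every orbit enters it. The ball contains finitely many points of \<open>X\<close>, so
  \<open>g\<close> permutes these among themselves, and an orbit that starts outside can never enter. Hence \<open>X\<close>
  is contained in the ball (\<open>bounded_if_permutation_near_contraction\<close>), but a net of a nonzero space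
  is unbounded.

  Conversely, a bounded displacement between separated nets is bilipschitz
  (\<open>bd_equivalent_imp_bilipschitz_equivalent\<close>), because the displacement is at most a constant
  multiple of the distance of any two distinct points. So a bilipschitz class is the union of the
  bounded displacement classes that it meets, and by scaling there are at least as many of these as
  positive reals.
\<close>

section \<open>Bounded displacements are bilipschitz\<close>

lemma bilipschitz_equivalentI:
  assumes bij: "bij_betw f X Y" and nonneg: "0 \<le> K" "0 \<le> L"
    and upper: "\<And>x y. x \<in> X \<Longrightarrow> y \<in> X \<Longrightarrow> norm (f x - f y) \<le> K * norm (x - y)"
    and lower: "\<And>x y. x \<in> X \<Longrightarrow> y \<in> X \<Longrightarrow> norm (x - y) \<le> L * norm (f x - f y)"
  shows "bilipschitz_equivalent X Y"
proof -
  have "K-lipschitz_on X f"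
    using upper nonneg by (intro lipschitz_onI) (auto simp: dist_norm)
  moreover have "L-lipschitz_on Y (inv_into X f)"
  proof (rule lipschitz_onI)
    fix y y' assume "y \<in> Y" "y' \<in> Y"
    then have "y \<in> f ` X" "y' \<in> f ` X" using bij by (auto simp: bij_betw_def)
    then show "dist (inv_into X f y) (inv_into X f y') \<le> L * dist y y'"
      using lower[of "inv_into X f y" "inv_into X f y'"]
      by (simp add: dist_norm inv_into_into f_inv_into_f)
  qed (use nonneg in simp)
  ultimately show ?thesis
    unfolding bilipschitz_equivalent_def using bij by blast
qed

text \<open>Distinct points of a separated set are at distance at least some \<open>\<delta>\<close>, so the additive error
  \<open>2 C\<close> of a displacement by at most \<open>C\<close> is absorbed in the factor \<open>1 + 2 C / \<delta>\<close>.\<close>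

lemma bounded_displacement_lipschitz:
  assumes "separated X" and C: "\<And>x. x \<in> X \<Longrightarrow> norm (f x - x) \<le> C"
  shows "\<exists>K\<ge>0. \<forall>x\<in>X. \<forall>y\<in>X. norm (f x - f y) \<le> K * norm (x - y)"
proof -
  obtain \<delta> where \<delta>: "\<delta> > 0" "\<And>x y. x \<in> X \<Longrightarrow> y \<in> X \<Longrightarrow> x \<noteq> y \<Longrightarrow> \<delta> \<le> norm (x - y)"
    using assms(1) unfolding separated_iff by blast
  define K where "K = 1 + 2 * \<bar>C\<bar> / \<delta>"
  have "norm (f x - f y) \<le> K * norm (x - y)" if "x \<in> X" "y \<in> X" for x y
  proof (cases "x = y")
    case False
    have "norm (f x - f y) \<le> norm (x - y) + 2 * \<bar>C\<bar>"
      using norm_triangle_ineq[of "f x - x" "x - y"] norm_triangle_ineq4[of "f x - y" "f y - y"]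
        C[OF that(1)] C[OF that(2)] by simp
    also have "2 * \<bar>C\<bar> = 2 * \<bar>C\<bar> / \<delta> * \<delta>"
      using \<delta>(1) by simp
    also have "\<dots> \<le> 2 * \<bar>C\<bar> / \<delta> * norm (x - y)"
      using \<delta> that False by (intro mult_left_mono) auto
    finally show ?thesis by (simp add: K_def algebra_simps)
  qed simp
  moreover have "K \<ge> 0" using \<delta>(1) by (simp add: K_def)
  ultimately show ?thesis by blast
qed

lemma bd_equivalent_imp_bilipschitz_equivalent:
  assumes "separated X" "separated Y" "bd_equivalent X Y"
  shows "bilipschitz_equivalent X Y"
proof -
  obtain f C where f: "bij_betw f X Y" "\<And>x. x \<in> X \<Longrightarrow> norm (f x - x) \<le> C"
    using assms(3) unfolding bd_equivalent_iff by blast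
  obtain K where K: "K \<ge> 0" "\<forall>x\<in>X. \<forall>y\<in>X. norm (f x - f y) \<le> K * norm (x - y)"
    using bounded_displacement_lipschitz[OF assms(1) f(2)] by blast
  let ?g = "inv_into X f"
  have g: "?g (f x) = x" if "x \<in> X" for x
    using f(1) that by (simp add: bij_betw_def)
  have Y: "Y = f ` X"
    using f(1) by (simp add: bij_betw_def)
  have "norm (?g y - y) \<le> C" if "y \<in> Y" for y
    using that f(2) g unfolding Y by (metis imageE norm_minus_commute)
  then obtain L where L: "L \<ge> 0" "\<forall>x\<in>Y. \<forall>y\<in>Y. norm (?g x - ?g y) \<le> L * norm (x - y)"
    using bounded_displacement_lipschitz[OF assms(2), of ?g C] by blast
  have "norm (x - y) \<le> L * norm (f x - f y)" if "x \<in> X" "y \<in> X" for x y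
    using L(2) g that unfolding Y by force
  then show ?thesis
    using K L(1) by (intro bilipschitz_equivalentI[OF f(1), of K L]) auto
qed

section \<open>Scaled nets\<close>

lemma separated_scaleR:
  assumes "separated X" "t > 0"
  shows "separated ((\<lambda>x. t *\<^sub>R x) ` X)"
proof -
  obtain \<delta> where \<delta>: "\<delta> > 0" "\<And>x y. x \<in> X \<Longrightarrow> y \<in> X \<Longrightarrow> x \<noteq> y \<Longrightarrow> \<delta> \<le> norm (x - y)"
    using assms(1) unfolding separated_iff by blast
  have "t * \<delta> \<le> norm (t *\<^sub>R x - t *\<^sub>R y)" if "x \<in> X" "y \<in> X" "t *\<^sub>R x \<noteq> t *\<^sub>R y" for x y
    using that \<delta>(2)[of x y] assms(2) by (simp flip: scaleR_diff_right)
  then show ?thesis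
    unfolding separated_iff using \<delta>(1) assms(2) by (intro exI[of _ "t * \<delta>"]) auto
qed

lemma net_scaleR:
  assumes "net X" "t > 0"
  shows "net ((\<lambda>x. t *\<^sub>R x) ` X)"
proof -
  obtain R where R: "\<And>x. \<exists>z\<in>X. norm (z - x) \<le> R"
    using assms(1) unfolding net_iff by blast
  have "\<exists>z\<in>X. norm (t *\<^sub>R z - x) \<le> t * R" for x
  proof -
    obtain z where z: "z \<in> X" "norm (z - x /\<^sub>R t) \<le> R" using R by blast
    have "norm (t *\<^sub>R z - x) = norm (t *\<^sub>R (z - x /\<^sub>R t))"
      using assms(2) by (simp add: scaleR_diff_right)
    also have "\<dots> \<le> t * R" using z(2) assms(2) by simp
    finally show ?thesis using z(1) by blast
  qed
  then show ?thesis unfolding net_iff by blast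
qed

lemma bilipschitz_equivalent_scaleR:
  assumes "t > 0"
  shows "bilipschitz_equivalent X ((\<lambda>x. t *\<^sub>R x) ` X)"
proof (rule bilipschitz_equivalentI)
  show "bij_betw (\<lambda>x. t *\<^sub>R x) X ((\<lambda>x. t *\<^sub>R x) ` X)"
    using assms by (simp add: bij_betw_def inj_on_def)
  show "norm (t *\<^sub>R x - t *\<^sub>R y) \<le> t * norm (x - y)"
    and "norm (x - y) \<le> 1 / t * norm (t *\<^sub>R x - t *\<^sub>R y)" for x y
    using assms by (simp_all flip: scaleR_diff_right)
qed (use assms in simp_all)

section \<open>Nets of different scales\<close>

lemma finite_separated_bounded:
  fixes X :: "'a::euclidean_space set"
  assumes "separated X" "bounded X"
  shows "finite X"
proof -
  have "uniform_discrete X"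
    using assms(1) unfolding separated_iff uniform_discrete_def dist_norm by (meson not_le)
  then show ?thesis using assms(2) uniform_discrete_finite_iff by blast
qed

lemma net_unbounded:
  fixes X :: "'a::euclidean_space set"
  assumes "net X"
  shows "\<not> bounded X"
proof
  assume "bounded X"
  then obtain B where B: "\<And>z. z \<in> X \<Longrightarrow> norm z \<le> B" unfolding bounded_iff by blast
  obtain R where R: "\<And>x. \<exists>z\<in>X. norm (z - x) \<le> R"
    using assms unfolding net_iff by blast
  have "norm x \<le> B + R" for x :: 'a
  proof -
    obtain z where "z \<in> X" "norm (z - x) \<le> R" using R by blast
    then show ?thesis using B[of z] norm_triangle_sub[of x z] by (simp add: norm_minus_commute)
  qed
  then have "bounded (UNIV :: 'a set)" unfolding bounded_iff by blast
  then show False by simp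
qed

text \<open>Norms along an orbit grow at most like iterates of \<open>u \<mapsto> r u + \<bar>C\<bar>\<close>, whose fixed point is
  \<open>c = \<bar>C\<bar> / (1 - r)\<close>. Every ball of radius at least \<open>c\<close> is therefore invariant; the radius \<open>c + 1\<close>
  is strictly larger, so that orbits, whose norms have upper limit at most \<open>c\<close>, also reach it.\<close>

lemma bounded_if_permutation_near_contraction:
  fixes X :: "'a::euclidean_space set"
  assumes sep: "separated X" and bij: "bij_betw g X X" and r: "0 \<le> r" "r < 1"
    and near: "\<And>x. x \<in> X \<Longrightarrow> norm (g x - r *\<^sub>R x) \<le> C"
  shows "bounded X"
proof -
  define c where "c = \<bar>C\<bar> / (1 - r)"
  define M where "M = c + 1"
  have c: "r * c + \<bar>C\<bar> = c"
    using r by (simp add: c_def field_simps)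
  have gX: "g x \<in> X" if "x \<in> X" for x
    using bij that by (auto simp: bij_betw_def)
  have step: "norm (g x) - c \<le> r * (norm x - c)" if "x \<in> X" for x
  proof -
    have "norm (g x) \<le> r * norm x + \<bar>C\<bar>"
      using norm_triangle_ineq[of "g x - r *\<^sub>R x" "r *\<^sub>R x"] near[OF that] r by simp
    then show ?thesis using c by (simp add: algebra_simps)
  qed
  define F where "F = X \<inter> cball 0 M"
  have "separated F"
    using sep unfolding separated_iff F_def by blast
  then have finF: "finite F"
    by (intro finite_separated_bounded) (auto simp: F_def intro: bounded_subset[OF bounded_cball])
  have "g ` F \<subseteq> F"
  proof
    fix y assume "y \<in> g ` F"
    then obtain x where x: "x \<in> X" "norm x \<le> M" "y = g x" by (auto simp: F_def)
    have "r * (norm x - c) \<le> r * 1"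
      using x(2) r by (intro mult_left_mono) (auto simp: M_def)
    then show "y \<in> F" using step[OF x(1)] x gX r by (auto simp: F_def M_def)
  qed
  moreover have inj: "inj_on g X" using bij by (simp add: bij_betw_def)
  moreover have FX: "F \<subseteq> X" by (simp add: F_def)
  ultimately have gF: "g ` F = F"
    using finF by (meson card_image card_subset_eq inj_on_subset)
  (* F is finite, so the injection g maps F onto F; a point outside F cannot land in F as well. *)
  have pull_back: "x \<in> F" if "x \<in> X" "g x \<in> F" for x
  proof -
    have "g x \<in> g ` F" using that(2) gF by simp
    then show ?thesis using inj_on_image_mem_iff[OF inj that(1) FX] by simp
  qed
  have "x \<in> F" if "x \<in> X" for x
  proof -
    have orbit: "(g ^^ n) x \<in> X \<and> norm ((g ^^ n) x) - c \<le> r ^ n * (norm x - c)" for n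
    proof (induction n)
      case (Suc n)
      have "norm (g ((g ^^ n) x)) - c \<le> r * (norm ((g ^^ n) x) - c)"
        using step Suc by blast
      also have "\<dots> \<le> r * (r ^ n * (norm x - c))"
        using Suc r by (intro mult_left_mono) auto
      finally show ?case using Suc gX by simp
    qed (use that in simp)
    have "(\<lambda>n. r ^ n * (norm x - c)) \<longlonglongrightarrow> 0"
      using r by (intro tendsto_mult_left_zero LIMSEQ_realpow_zero)
    then have "eventually (\<lambda>n. r ^ n * (norm x - c) < 1) sequentially"
      by (rule order_tendstoD) simp
    then obtain n where "r ^ n * (norm x - c) < 1"
      unfolding eventually_sequentially by blast
    then have "(g ^^ n) x \<in> F" using orbit[of n] by (simp add: F_def M_def)
    then show ?thesis
    proof (induction n)
      case (Suc n)
      then show ?case using pull_back orbit by simp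
    qed simp
  qed
  then show ?thesis using finF by (meson finite_imp_bounded finite_subset subsetI)
qed

lemma not_bd_equivalent_scaleR:
  fixes X :: "'a::euclidean_space set"
  assumes "separated X" "net X" and ts: "0 < t" "t < s"
  shows "\<not> bd_equivalent ((\<lambda>x. t *\<^sub>R x) ` X) ((\<lambda>x. s *\<^sub>R x) ` X)"
proof
  assume "bd_equivalent ((\<lambda>x. t *\<^sub>R x) ` X) ((\<lambda>x. s *\<^sub>R x) ` X)"
  then obtain f C where f: "bij_betw f ((\<lambda>x. t *\<^sub>R x) ` X) ((\<lambda>x. s *\<^sub>R x) ` X)"
    and C: "\<And>x. x \<in> X \<Longrightarrow> norm (f (t *\<^sub>R x) - t *\<^sub>R x) \<le> C"
    unfolding bd_equivalent_iff by blast
  define g where "g x = f (t *\<^sub>R x) /\<^sub>R s" for x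
  have "bij_betw (\<lambda>x. t *\<^sub>R x) X ((\<lambda>x. t *\<^sub>R x) ` X)"
    using ts by (auto simp: bij_betw_def inj_on_def)
  moreover have "bij_betw (\<lambda>y. y /\<^sub>R s) ((\<lambda>x. s *\<^sub>R x) ` X) X"
    using ts by (auto simp: bij_betw_def inj_on_def image_image)
  ultimately have "bij_betw ((\<lambda>y. y /\<^sub>R s) \<circ> (f \<circ> (\<lambda>x. t *\<^sub>R x))) X X"
    using f bij_betw_trans by blast
  then have "bij_betw g X X"
    by (simp add: g_def[abs_def] comp_def)
  moreover have "norm (g x - (t / s) *\<^sub>R x) \<le> C / s" if "x \<in> X" for x
  proof -
    have "g x - (t / s) *\<^sub>R x = (f (t *\<^sub>R x) - t *\<^sub>R x) /\<^sub>R s"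
      by (simp add: g_def scaleR_diff_right divide_inverse mult.commute)
    then show ?thesis using C[OF that] ts by (simp add: divide_inverse_commute)
  qed
  ultimately have "bounded X"
    using ts assms(1) by (intro bounded_if_permutation_near_contraction[of X g "t / s" "C / s"]) auto
  then show False using net_unbounded assms(2) by blast
qed

section \<open>Decomposition of a bilipschitz class\<close>

theorem theorem5p1:
  fixes \<C> :: "(real ^ 'd) set set"
  assumes "\<C> \<in> separated_nets // bilipschitz_rel"
  shows "\<exists>\<B>. \<B> \<subseteq> separated_nets // bd_rel \<and> uncountable \<B> \<and> \<C> = \<Union>\<B>"
proof -
  obtain X where X: "X \<in> separated_nets" "\<C> = bilipschitz_rel `` {X}"
    using assms by (rule quotientE)
  then have nets: "\<C> \<subseteq> separated_nets" by (auto simp: bilipschitz_rel_def)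
  have closed: "Z \<in> \<C>" if "Y \<in> \<C>" "(Y, Z) \<in> bd_rel" for Y Z
  proof -
    have "(Y, Z) \<in> bilipschitz_rel"
      using that(2) bd_equivalent_imp_bilipschitz_equivalent
      by (auto simp: bd_rel_def bilipschitz_rel_def separated_nets_def)
    then show ?thesis
      using that(1) X equiv_bilipschitz_rel unfolding equiv_def by (auto elim: transE)
  qed
  define S where "S t = (\<lambda>x. t *\<^sub>R x) ` X" for t :: real
  have S_net: "S t \<in> separated_nets" if "t > 0" for t
    using X(1) that separated_scaleR net_scaleR by (auto simp: separated_nets_def S_def)
  have S_class: "S t \<in> \<C>" if "t > 0" for t
    using X S_net[OF that] bilipschitz_equivalent_scaleR[OF that, of X]
    by (auto simp: bilipschitz_rel_def S_def)
  have "inj_on (\<lambda>t. bd_rel `` {S t}) {0<..}"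
  proof (rule linorder_inj_onI)
    fix t s :: real assume ts: "t < s" "t \<in> {0<..}"
    then have "\<not> bd_equivalent (S t) (S s)"
      using not_bd_equivalent_scaleR X(1) by (auto simp: separated_nets_def S_def)
    then show "bd_rel `` {S t} \<noteq> bd_rel `` {S s}"
      using eq_equiv_class[OF _ equiv_bd_rel S_net[of s]] ts by (auto simp: bd_rel_def)
  qed auto
  moreover have "uncountable {0::real<..}"
    using uncountable_open_interval[of 0 "1::real"] countable_subset[of "{0<..<1::real}" "{0<..}"]
    by (simp add: subset_iff) blast
  ultimately have "uncountable ((\<lambda>t. bd_rel `` {S t}) ` {0::real<..})"
    using countable_image_inj_on by blast
  moreover have "(\<lambda>t. bd_rel `` {S t}) ` {0<..} \<subseteq> \<C> // bd_rel"
    using S_class by (auto intro: quotientI)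
  ultimately have "uncountable (\<C> // bd_rel)"
    using countable_subset by blast
  moreover have "\<C> // bd_rel \<subseteq> separated_nets // bd_rel"
    using nets by (auto simp: quotient_def)
  moreover have "\<C> = \<Union>(\<C> // bd_rel)"
  proof
    show "\<C> \<subseteq> \<Union>(\<C> // bd_rel)"
      using nets equiv_class_self[OF equiv_bd_rel] by (auto simp: quotient_def)
    show "\<Union>(\<C> // bd_rel) \<subseteq> \<C>"
      using closed by (auto simp: quotient_def)
  qed
  ultimately show ?thesis by blast
qed

end
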